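(* Let $\mathcal{P}=(V;\leq_{\mathcal{P}})$ be a finite poset and let $\varphi:\mathcal{I}(\mathcal{P})\to\mathcal{I}(\mathcal{P})$ be an idempotent Steiner operation ($\varphi\circ\varphi=\varphi$). Then there exists a unique partial order $\leq_{\mathcal{Q}}$ on $V$ with $\leq_{\mathcal{P}}\subseteq\leq_{\mathcal{Q}}$ (as subsets of $V\times V$) such that, writing $\mathcal{Q}=(V;\leq_{\mathcal{Q}})$, \[ \mathrm{Range}(\varphi)=\mathcal{I}(\mathcal{Q}). \]
   Context: For a finite poset $\mathcal{P}=(V;\leq)$, a set $I\subseteq V$ is an (order) ideal if $y\in I$ and $x\leq y$ imply $x\in I$; $\mathcal{I}(\mathcal{P})$ denotes the set of all ideals of $\mathcal{P}$. Let $n=|V|$. A Steiner operation (StOp) is a map $\varphi:\mathcal{I}(\mathcal{P})\to\mathcal{I}(\mathcal{P})$, together with a boundary functional $\partial:2^V\to\mathbb{R}$, satisfying: (1) $|\varphi(S)|=|S|$ for all $S\in\mathcal{I}(\mathcal{P})$; (2) $\partial(\varphi(S))\leq\partial(S)$ for all $S\in\mathcal{I}(\mathcal{P})$; (3) $S\subseteq T$ implies $\varphi(S)\subseteq\varphi(T)$; (4) there is a bijection $\tau:V\to\{0,1,\dots,n-1\}$ with $x\leq y\Rightarrow\tau(x)\leq\tau(y)$ such that, writing $\tau(S)=\sum_{x\in S}\tau(x)$, for all $S\in\mathcal{I}(\mathcal{P})$ one has $\tau(\varphi(S))\leq\tau(S)$, and $\tau(\varphi(S))=\tau(S)$ implies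 $\varphi(S)=S$. $\mathrm{Range}(\varphi)=\{T\in\mathcal{I}(\mathcal{P}):\exists S\in\mathcal{I}(\mathcal{P}),\ \varphi(S)=T\}$. (The order $\mathcal{Q}$ in the conclusion is called the StOp-order of $\varphi$.) *)

theory Defs
  imports Complex_Main "HOL-Library.FuncSet"
begin

definition order_ideals :: "'a set \<Rightarrow> 'a rel \<Rightarrow> 'a set set" where
  "order_ideals V r = {I. I \<subseteq> V \<and> (\<forall>y\<in>I. \<forall>x\<in>V. (x, y) \<in> r \<longrightarrow> x \<in> I)}"

(* Only the values of \<phi> on ideals and of bd on subsets of V are ever used. *)
definition steiner_operation ::
  "'a set \<Rightarrow> 'a rel \<Rightarrow> ('a set \<Rightarrow> real) \<Rightarrow> ('a set \<Rightarrow> 'a set) \<Rightarrow> bool" where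
  "steiner_operation V r bd \<phi> \<longleftrightarrow>
     \<phi> \<in> order_ideals V r \<rightarrow> order_ideals V r \<and>
     (\<forall>S\<in>order_ideals V r. card (\<phi> S) = card S) \<and>
     (\<forall>S\<in>order_ideals V r. bd (\<phi> S) \<le> bd S) \<and>
     (\<forall>S\<in>order_ideals V r. \<forall>T\<in>order_ideals V r. S \<subseteq> T \<longrightarrow> \<phi> S \<subseteq> \<phi> T) \<and>
     (\<exists>\<tau> :: 'a \<Rightarrow> nat.
        bij_betw \<tau> V {0..<card V} \<and>
        (\<forall>x\<in>V. \<forall>y\<in>V. (x, y) \<in> r \<longrightarrow> \<tau> x \<le> \<tau> y) \<and>
        (\<forall>S\<in>order_ideals V r.
           sum \<tau> (\<phi> S) \<le> sum \<tau> S \<and>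
           (sum \<tau> (\<phi> S) = sum \<tau> S \<longrightarrow> \<phi> S = S)))"

definition stop_range :: "'a set \<Rightarrow> 'a rel \<Rightarrow> ('a set \<Rightarrow> 'a set) \<Rightarrow> 'a set set" where
  "stop_range V r \<phi> = {T \<in> order_ideals V r. \<exists>S\<in>order_ideals V r. \<phi> S = T}"

end

theory Submission
  imports Defs
begin

text \<open>
  Since \<open>\<phi>\<close> is monotone and preserves cardinality, its fixed ideals, which by idempotence form
  its range, are closed under unions and intersections and include \<open>{}\<close> and \<open>V\<close>; hence
  they are the ideals of the preorder ``every fixed ideal containing \<open>y\<close> contains \<open>x\<close>''.
  This preorder is antisymmetric because \<open>\<phi>\<close> maps the chain of initial segments of \<open>\<tau>\<close> to a
  chain of fixed ideals from \<open>{}\<close> to \<open>V\<close> that gains at most one point in each step, and such a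
  chain separates points.  Uniqueness holds because a partial order is determined by its ideals.
\<close>

text \<open>The members of \<open>L\<close> act as closed sets: \<open>x\<close> lies below \<open>y\<close> iff \<open>x\<close> is in the closure of \<open>{y}\<close>.\<close>
definition specialization_preorder :: "'a set \<Rightarrow> 'a set set \<Rightarrow> 'a rel" where
  "specialization_preorder V L = {(x, y) \<in> V \<times> V. \<forall>T\<in>L. y \<in> T \<longrightarrow> x \<in> T}"

definition separates_points :: "'a set \<Rightarrow> 'a set set \<Rightarrow> bool" where
  "separates_points V L \<longleftrightarrow> (\<forall>x\<in>V. \<forall>y\<in>V. x \<noteq> y \<longrightarrow> (\<exists>T\<in>L. x \<in> T \<longleftrightarrow> y \<notin> T))"

lemma preorder_on_specialization_preorder: "preorder_on V (specialization_preorder V L)"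
  by (auto simp: preorder_on_def refl_on_def trans_def specialization_preorder_def)

lemma partial_order_on_specialization_preorder_iff:
  "partial_order_on V (specialization_preorder V L) \<longleftrightarrow> separates_points V L"
proof -
  have "antisym (specialization_preorder V L) \<longleftrightarrow>
      (\<forall>x\<in>V. \<forall>y\<in>V. (\<forall>T\<in>L. x \<in> T \<longleftrightarrow> y \<in> T) \<longrightarrow> x = y)"
    by (simp add: antisym_def specialization_preorder_def) metis
  also have "\<dots> \<longleftrightarrow> separates_points V L"
    unfolding separates_points_def by metis
  finally show ?thesis
    by (simp add: partial_order_on_def preorder_on_specialization_preorder)
qed

lemma specialization_preorder_antimono:
  "L \<subseteq> M \<Longrightarrow> specialization_preorder V M \<subseteq> specialization_preorder V L"
  by (auto simp: specialization_preorder_def)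

lemma under_mem_order_ideals:
  assumes "preorder_on V r"
  shows "under r y \<in> order_ideals V r"
  using assms by (auto simp: preorder_on_def under_def order_ideals_def dest: transD)

lemma order_ideal_eq_UN_under:
  assumes r: "preorder_on V r" and I: "I \<in> order_ideals V r"
  shows "I = (\<Union>y\<in>I. under r y)"
proof
  show "I \<subseteq> (\<Union>y\<in>I. under r y)"
    using assms by (auto simp: preorder_on_def order_ideals_def under_def refl_on_def)
  show "(\<Union>y\<in>I. under r y) \<subseteq> I"
    using assms unfolding preorder_on_def order_ideals_def under_def by blast
qed

lemma specialization_preorder_order_ideals:
  assumes r: "preorder_on V r"
  shows "specialization_preorder V (order_ideals V r) = r"
proof (intro subset_antisym subrelI)
  fix x y assume xy: "(x, y) \<in> specialization_preorder V (order_ideals V r)"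
  then have "y \<in> under r y"
    using r by (auto simp: specialization_preorder_def preorder_on_def under_def refl_on_def)
  then have "x \<in> under r y"
    using xy under_mem_order_ideals[OF r] by (auto simp: specialization_preorder_def)
  then show "(x, y) \<in> r" by (simp add: under_def)
next
  fix x y assume "(x, y) \<in> r"
  then show "(x, y) \<in> specialization_preorder V (order_ideals V r)"
    using r by (auto simp: specialization_preorder_def preorder_on_def order_ideals_def)
qed

locale set_lattice =
  fixes V :: "'a set" and L :: "'a set set"
  assumes subset_carrier: "S \<in> L \<Longrightarrow> S \<subseteq> V"
    and empty_mem: "{} \<in> L"
    and carrier_mem: "V \<in> L"
    and Int_mem: "S \<in> L \<Longrightarrow> T \<in> L \<Longrightarrow> S \<inter> T \<in> L"
    and Un_mem: "S \<in> L \<Longrightarrow> T \<in> L \<Longrightarrow> S \<union> T \<in> L"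
begin

lemma Inter_mem:
  assumes "finite F" "F \<noteq> {}" "F \<subseteq> L"
  shows "\<Inter>F \<in> L"
  using assms by (induction rule: finite_ne_induct) (auto intro: Int_mem)

lemma Union_mem:
  assumes "finite F" "F \<subseteq> L"
  shows "\<Union>F \<in> L"
  using assms by (induction rule: finite_induct) (auto intro: empty_mem Un_mem)

lemma under_specialization_preorder_mem:
  assumes "finite V" "y \<in> V"
  shows "under (specialization_preorder V L) y \<in> L"
proof -
  have "finite L"
    using assms(1) subset_carrier by (auto intro: finite_subset[of L "Pow V"])
  then have "\<Inter>{T \<in> L. y \<in> T} \<in> L"
    using carrier_mem \<open>y \<in> V\<close> by (intro Inter_mem) auto
  also have "\<Inter>{T \<in> L. y \<in> T} = under (specialization_preorder V L) y"
    using carrier_mem \<open>y \<in> V\<close> by (auto simp: under_def specialization_preorder_def)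
  finally show ?thesis .
qed

lemma order_ideals_specialization_preorder:
  assumes "finite V"
  shows "order_ideals V (specialization_preorder V L) = L"
proof (intro subset_antisym subsetI)
  fix I assume "I \<in> L"
  then show "I \<in> order_ideals V (specialization_preorder V L)"
    using subset_carrier by (auto simp: order_ideals_def specialization_preorder_def)
next
  fix I assume I: "I \<in> order_ideals V (specialization_preorder V L)"
  then have "I \<subseteq> V" by (simp add: order_ideals_def)
  then have "(\<Union>y\<in>I. under (specialization_preorder V L) y) \<in> L"
    using assms finite_subset[OF \<open>I \<subseteq> V\<close> assms]
    by (intro Union_mem) (auto intro: under_specialization_preorder_mem)
  then show "I \<in> L"
    using order_ideal_eq_UN_under[OF preorder_on_specialization_preorder I] by simp
qed

end

lemma set_lattice_order_ideals: "set_lattice V (order_ideals V r)"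
  by unfold_locales (auto simp: order_ideals_def)

text \<open>Consecutive members may coincide, so \<open>n\<close> can exceed \<open>card V\<close>.\<close>
definition complete_flag :: "'a set \<Rightarrow> 'a set set \<Rightarrow> nat \<Rightarrow> (nat \<Rightarrow> 'a set) \<Rightarrow> bool" where
  "complete_flag V L n C \<longleftrightarrow> C 0 = {} \<and> C n = V \<and> (\<forall>k\<le>n. C k \<in> L) \<and>
     (\<forall>k<n. C k \<subseteq> C (Suc k) \<and> (\<exists>v. C (Suc k) \<subseteq> insert v (C k)))"

lemma complete_flag_imp_separates_points:
  assumes flag: "complete_flag V L n C"
  shows "separates_points V L"
  unfolding separates_points_def
proof (intro ballI impI)
  fix x y assume "x \<in> V" "y \<in> V" "x \<noteq> y"
  have "x \<in> C n" "x \<notin> C 0" using flag \<open>x \<in> V\<close> by (auto simp: complete_flag_def)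
  then obtain k where k: "k < n" "x \<notin> C k" "x \<in> C (Suc k)"
    using ex_least_nat_less[of "\<lambda>k. x \<in> C k" n] by auto
  obtain v where v: "C (Suc k) \<subseteq> insert v (C k)"
    using flag k by (auto simp: complete_flag_def)
  have "y \<in> C k" if "y \<in> C (Suc k)"
    using v k that \<open>x \<noteq> y\<close> by auto
  then consider "y \<in> C k" | "y \<notin> C (Suc k)" by blast
  moreover have "C k \<in> L" "C (Suc k) \<in> L"
    using flag k by (auto simp: complete_flag_def)
  ultimately show "\<exists>T\<in>L. x \<in> T \<longleftrightarrow> y \<notin> T"
    using k by cases auto
qed

lemma complete_flag_initial_segments:
  fixes \<tau> :: "'a \<Rightarrow> nat"
  assumes inj: "inj_on \<tau> V" and bound: "\<tau> ` V \<subseteq> {..<n}"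
    and mono: "\<And>x y. x \<in> V \<Longrightarrow> y \<in> V \<Longrightarrow> (x, y) \<in> r \<Longrightarrow> \<tau> x \<le> \<tau> y"
  shows "complete_flag V (order_ideals V r) n (\<lambda>k. {v \<in> V. \<tau> v < k})"
proof -
  have "{v \<in> V. \<tau> v < k} \<in> order_ideals V r" for k
    using mono by (fastforce simp: order_ideals_def)
  moreover have "{v \<in> V. \<tau> v < Suc k} \<subseteq> insert (inv_into V \<tau> k) {v \<in> V. \<tau> v < k}" for k
    using inj by (auto simp: less_Suc_eq)
  ultimately show ?thesis
    using bound by (auto simp: complete_flag_def)
qed

locale card_preserving_map = set_lattice +
  fixes \<phi> :: "'a set \<Rightarrow> 'a set"
  assumes finite_carrier: "finite V"
    and map_mem: "S \<in> L \<Longrightarrow> \<phi> S \<in> L"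
    and card_map: "S \<in> L \<Longrightarrow> card (\<phi> S) = card S"
    and map_mono: "S \<in> L \<Longrightarrow> T \<in> L \<Longrightarrow> S \<subseteq> T \<Longrightarrow> \<phi> S \<subseteq> \<phi> T"
begin

lemma finite_mem: "S \<in> L \<Longrightarrow> finite S"
  using finite_carrier subset_carrier finite_subset by blast

lemma map_eq_if_map_subset: "S \<in> L \<Longrightarrow> \<phi> S \<subseteq> S \<Longrightarrow> \<phi> S = S"
  by (simp add: card_subset_eq finite_mem card_map)

lemma map_eq_if_subset_map: "S \<in> L \<Longrightarrow> S \<subseteq> \<phi> S \<Longrightarrow> \<phi> S = S"
  using card_subset_eq[of "\<phi> S" S] by (simp add: finite_mem map_mem card_map)

lemma map_empty: "\<phi> {} = {}"
  by (simp add: map_eq_if_subset_map empty_mem)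

lemma map_carrier: "\<phi> V = V"
  by (simp add: map_eq_if_map_subset carrier_mem map_mem subset_carrier)

lemma set_lattice_fixed_points: "set_lattice V {T \<in> L. \<phi> T = T}"
proof
  fix S T assume "S \<in> {T \<in> L. \<phi> T = T}" "T \<in> {T \<in> L. \<phi> T = T}"
  then have S: "S \<in> L" "\<phi> S = S" and T: "T \<in> L" "\<phi> T = T" by auto
  have "\<phi> (S \<inter> T) \<subseteq> S \<inter> T"
    using map_mono[of "S \<inter> T" S] map_mono[of "S \<inter> T" T] S T Int_mem by auto
  then show "S \<inter> T \<in> {T \<in> L. \<phi> T = T}"
    using S T by (simp add: Int_mem map_eq_if_map_subset)
  have "S \<union> T \<subseteq> \<phi> (S \<union> T)"
    using map_mono[of S "S \<union> T"] map_mono[of T "S \<union> T"] S T Un_mem by auto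
  then show "S \<union> T \<in> {T \<in> L. \<phi> T = T}"
    using S T by (simp add: Un_mem map_eq_if_subset_map)
qed (auto simp: empty_mem carrier_mem map_empty map_carrier dest: subset_carrier)

lemma set_lattice_image_if_idempotent:
  assumes "\<And>S. S \<in> L \<Longrightarrow> \<phi> (\<phi> S) = \<phi> S"
  shows "set_lattice V (\<phi> ` L)"
proof -
  have "\<phi> ` L = {T \<in> L. \<phi> T = T}"
    using assms map_mem by (force simp: image_iff)
  then show ?thesis by (simp add: set_lattice_fixed_points)
qed

lemma map_subset_insert:
  assumes S: "S \<in> L" and T: "T \<in> L" and "S \<subseteq> T" "T \<subseteq> insert v S"
  shows "\<exists>w. \<phi> T \<subseteq> insert w (\<phi> S)"
proof -
  have "card (\<phi> T - \<phi> S) = card (\<phi> T) - card (\<phi> S)"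
    using assms by (intro card_Diff_subset map_mono finite_mem map_mem)
  also have "\<dots> = card (T - S)"
    using assms by (simp add: card_map card_Diff_subset finite_mem)
  also have "\<dots> \<le> card {v}"
    using assms by (intro card_mono) auto
  finally have "\<forall>a\<in>\<phi> T - \<phi> S. \<forall>b\<in>\<phi> T - \<phi> S. a = b"
    using T by (simp add: card_le_Suc0_iff_eq finite_mem map_mem)
  then show ?thesis by blast
qed

lemma complete_flag_image:
  assumes "complete_flag V L n C"
  shows "complete_flag V (\<phi> ` L) n (\<lambda>k. \<phi> (C k))"
proof -
  have "\<phi> (C k) \<subseteq> \<phi> (C (Suc k)) \<and> (\<exists>w. \<phi> (C (Suc k)) \<subseteq> insert w (\<phi> (C k)))"
    if "k < n" for k
  proof -
    obtain v where "C k \<in> L" "C (Suc k) \<in> L" "C k \<subseteq> C (Suc k)" "C (Suc k) \<subseteq> insert v (C k)"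
      using assms \<open>k < n\<close> by (auto simp: complete_flag_def)
    then show ?thesis by (intro conjI map_mono map_subset_insert)
  qed
  then show ?thesis
    using assms by (simp add: complete_flag_def map_empty map_carrier)
qed

end

lemma card_preserving_map_if_steiner_operation:
  assumes "finite V" "steiner_operation V r bd \<phi>"
  shows "card_preserving_map V (order_ideals V r) \<phi>"
proof -
  interpret set_lattice V "order_ideals V r" by (rule set_lattice_order_ideals)
  show ?thesis
    using assms by unfold_locales (auto simp: steiner_operation_def)
qed

lemma stop_range_eq_image:
  assumes "steiner_operation V r bd \<phi>"
  shows "stop_range V r \<phi> = \<phi> ` order_ideals V r"
  using assms by (auto simp: steiner_operation_def stop_range_def)

lemma steiner_operation_obtains_complete_flag:
  assumes "steiner_operation V r bd \<phi>"
  obtains n C where "complete_flag V (order_ideals V r) n C"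
proof -
  obtain \<tau> :: "'a \<Rightarrow> nat" where "bij_betw \<tau> V {0..<card V}"
    and mono: "\<And>x y. x \<in> V \<Longrightarrow> y \<in> V \<Longrightarrow> (x, y) \<in> r \<Longrightarrow> \<tau> x \<le> \<tau> y"
    using assms unfolding steiner_operation_def by (elim conjE exE) simp
  then have "inj_on \<tau> V" "\<tau> ` V \<subseteq> {..<card V}"
    by (auto simp: bij_betw_def)
  then show thesis
    by (rule that[OF complete_flag_initial_segments[OF _ _ mono]])
qed

theorem theorem3:
  fixes V :: "'a set" and P :: "'a rel"
    and bd :: "'a set \<Rightarrow> real" and \<phi> :: "'a set \<Rightarrow> 'a set"
  assumes "finite V"
    and "partial_order_on V P"
    and "steiner_operation V P bd \<phi>"
    and "\<forall>S\<in>order_ideals V P. \<phi> (\<phi> S) = \<phi> S"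
  shows "\<exists>!Q. partial_order_on V Q \<and> P \<subseteq> Q \<and> stop_range V P \<phi> = order_ideals V Q"
proof (intro ex1I conjI)
  interpret card_preserving_map V "order_ideals V P" \<phi>
    using assms by (intro card_preserving_map_if_steiner_operation)
  let ?L = "stop_range V P \<phi>"
  let ?Q = "specialization_preorder V ?L"
  have L: "?L = \<phi> ` order_ideals V P" using assms(3) by (rule stop_range_eq_image)
  obtain n C where "complete_flag V (order_ideals V P) n C"
    using assms(3) by (rule steiner_operation_obtains_complete_flag)
  then have "separates_points V ?L"
    unfolding L by (rule complete_flag_imp_separates_points[OF complete_flag_image])
  then show "partial_order_on V ?Q" by (simp add: partial_order_on_specialization_preorder_iff)
  have "P = specialization_preorder V (order_ideals V P)"
    using assms(2) by (simp add: partial_order_on_def specialization_preorder_order_ideals)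
  also have "\<dots> \<subseteq> ?Q"
    by (intro specialization_preorder_antimono) (auto simp: stop_range_def)
  finally show "P \<subseteq> ?Q" .
  have "set_lattice V ?L" unfolding L using assms(4) by (simp add: set_lattice_image_if_idempotent)
  then show "?L = order_ideals V ?Q"
    using assms(1) by (simp add: set_lattice.order_ideals_specialization_preorder)
  show "R = ?Q" if "partial_order_on V R \<and> P \<subseteq> R \<and> ?L = order_ideals V R" for R
    using that by (simp add: partial_order_on_def specialization_preorder_order_ideals)
qed

end
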